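(* Let $\mathcal G$ be Grigorchuk group, acting on the binary rooted tree $\mathcal T$. For any element $g\in\mathcal G$, the portrait decoration $\alpha_u=\alpha_u(g)$ and the associated values $\beta_{xy}=\beta_{xy}(g)\in\mathbb{Z}/2\mathbb{Z}$ satisfy the following constraints. (i) If $\alpha_0=\alpha_1=0$ then $\beta_{00}=\beta_{11}=\beta_{01}=\beta_{10}$. (ii) If $\alpha_0=0$ and $\alpha_1=1$ then $\beta_{00}\neq\beta_{11}=\beta_{01}=\beta_{10}$. (iii) If $\alpha_0=1$ and $\alpha_1=0$ then $\beta_{00}=\beta_{11}=\beta_{01}\neq\beta_{10}$. (iv) If $\alpha_0=\alpha_1=1$ then $\beta_{00}=\beta_{11}\neq\beta_{01}=\beta_{10}$.
   Context: Tree. Let $X=\{0,1\}$. The vertices of the binary rooted tree $\mathcal T$ are the finite words over $X$; the empty word $\emptyset$ is the root, $X^n$ is level $n$, and each vertex $u$ has two children $u0$ and $u1$. $\mathrm{Aut}(\mathcal T)$ is the group of automorphisms of the rooted tree $\mathcal T$; it acts on the right, so $w^{gh}=(w^g)^h$. It decomposes as $\mathrm{Aut}(\mathcal T)=(\mathrm{Aut}(\mathcal T)\times\mathrm{Aut}(\mathcal T))\rtimes \mathsf S(2)$ with $\mathsf S(2)=\{1,\sigma\}$, $\sigma=(01)$: every $g$ is uniquely written $g=(g_0,g_1)\sigma^{\varepsilon}$, $\varepsilon\in\{0,1\}$, where $g=(g_0,g_1)$ acts by $(0w)^g=0w^{g_0}$, $(1w)^g=1w^{g_1}$, and $g=(g_0,g_1)\sigma$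 acts by $(0w)^g=1w^{g_0}$, $(1w)^g=0w^{g_1}$, for all words $w$ over $X$. Sections. $g_0,g_1$ above are the sections of $g$ at $0$ and $1$; the section $g_u$ at any vertex $u$ is defined recursively by $g_\emptyset=g$, $g_{ux}=(g_u)_x$ for a word $u$ and a letter $x\in X$. Grigorchuk group. $\mathcal G$ is the subgroup of $\mathrm{Aut}(\mathcal T)$ generated by the automorphisms $a,b,c,d$ defined by $a=(1,1)\sigma$, $b=(a,c)$, $c=(a,d)$, $d=(1,b)$. Portrait decoration. For $g\in\mathrm{Aut}(\mathcal T)$ and a vertex $u$, write $g_u=(g_{u0},g_{u1})\sigma^{\varepsilon}$ with $\varepsilon\in\{0,1\}$ and set $\alpha_u(g)=\varepsilon$ (i.e. $\alpha_u(g)=1$ if $g$ is active at $u$, meaning $g_u$ swaps the two vertices of level 1, and $\alpha_u(g)=0$ otherwise). For every vertex $xy$ on level 2 ($x,y\in X$) define $$\beta_{xy}(g)=\alpha_{xy}(g)+\alpha_{x\bar y0}(g)+\alpha_{x\bar y1}(g) \pmod 2,$$ where $\bar y$ denotes the letter of $\{0,1\}$ different from $y$. *)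

theory Defs
  imports "HOL-Algebra.Generated_Groups" "HOL-Library.Z2"
begin

text \<open>
  The type \<^typ>\<open>bit\<close> serves both as the alphabet \<open>X = {0, 1}\<close> and as the field
  \<open>\<int>/2\<int>\<close>, so \<open>y + 1\<close> is the letter different from \<open>y\<close>. An automorphism is the
  function \<open>w \<mapsto> w\<^sup>g\<close> on words.
\<close>

type_synonym vertex = "bit list"

definition child :: "vertex \<Rightarrow> vertex \<Rightarrow> bool" where
  "child u v \<longleftrightarrow> (\<exists>x. v = u @ [x])"

definition adjacent :: "vertex \<Rightarrow> vertex \<Rightarrow> bool" where
  "adjacent u v \<longleftrightarrow> child u v \<or> child v u"

text \<open>The action is on the right, so the product \<open>g h\<close> applies \<open>g\<close> first.\<close>

definition aut_tree :: "(vertex \<Rightarrow> vertex) monoid" where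
  "aut_tree =
    \<lparr>carrier = {g. bij g \<and> g [] = [] \<and> (\<forall>u v. adjacent (g u) (g v) \<longleftrightarrow> adjacent u v)},
     mult = (\<lambda>g h. h \<circ> g), one = id\<rparr>"

text \<open>\<open>wreath g0 g1 e\<close> is the automorphism \<open>(g0, g1) \<sigma>\<^sup>e\<close>.\<close>

fun wreath :: "(vertex \<Rightarrow> vertex) \<Rightarrow> (vertex \<Rightarrow> vertex) \<Rightarrow> bit \<Rightarrow> vertex \<Rightarrow> vertex" where
  "wreath g0 g1 e [] = []"
| "wreath g0 g1 e (x # w) = (x + e) # (if x = 0 then g0 w else g1 w)"

text \<open>
  The components of the decomposition \<open>g = (g0, g1) \<sigma>\<^sup>e\<close>; see \<open>wreath_decomposition\<close>
  and \<open>wreath_unique\<close> below.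
\<close>

definition section1 :: "(vertex \<Rightarrow> vertex) \<Rightarrow> bit \<Rightarrow> vertex \<Rightarrow> vertex" where
  "section1 g x = (\<lambda>w. tl (g (x # w)))"

definition root_activity :: "(vertex \<Rightarrow> vertex) \<Rightarrow> bit" where
  "root_activity g = hd (g [0])"

definition section_at :: "(vertex \<Rightarrow> vertex) \<Rightarrow> vertex \<Rightarrow> vertex \<Rightarrow> vertex" where
  "section_at g u = foldl section1 g u"

lemma section_at_Nil: "section_at g [] = g"
  by (simp add: section_at_def)

lemma section_at_snoc: "section_at g (u @ [x]) = section1 (section_at g u) x"
  by (simp add: section_at_def)

definition alpha :: "(vertex \<Rightarrow> vertex) \<Rightarrow> vertex \<Rightarrow> bit" where
  "alpha g u = root_activity (section_at g u)"

definition beta :: "(vertex \<Rightarrow> vertex) \<Rightarrow> bit \<Rightarrow> bit \<Rightarrow> bit" where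
  "beta g x y = alpha g [x, y] + alpha g [x, y + 1, 0] + alpha g [x, y + 1, 1]"

fun grig_a :: "vertex \<Rightarrow> vertex" where
  "grig_a [] = []"
| "grig_a (x # w) = (x + 1) # w"

fun grig_b grig_c grig_d :: "vertex \<Rightarrow> vertex" where
  "grig_b [] = []"
| "grig_b (x # w) = x # (if x = 0 then grig_a w else grig_c w)"
| "grig_c [] = []"
| "grig_c (x # w) = x # (if x = 0 then grig_a w else grig_d w)"
| "grig_d [] = []"
| "grig_d (x # w) = x # (if x = 0 then w else grig_b w)"

definition grigorchuk :: "(vertex \<Rightarrow> vertex) set" where
  "grigorchuk = generate aut_tree {grig_a, grig_b, grig_c, grig_d}"

lemma grig_a_wreath: "grig_a = wreath id id 1"
proof
  show "grig_a w = wreath id id 1 w" for w by (cases w) auto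
qed

lemma grig_b_wreath: "grig_b = wreath grig_a grig_c 0"
proof
  show "grig_b w = wreath grig_a grig_c 0 w" for w by (cases w) auto
qed

lemma grig_c_wreath: "grig_c = wreath grig_a grig_d 0"
proof
  show "grig_c w = wreath grig_a grig_d 0 w" for w by (cases w) auto
qed

lemma grig_d_wreath: "grig_d = wreath id grig_b 0"
proof
  show "grig_d w = wreath id grig_b 0 w" for w by (cases w) auto
qed

lemma aut_tree_carrierI:
  assumes "bij g" "g [] = []" "\<And>u v. adjacent (g u) (g v) \<longleftrightarrow> adjacent u v"
  shows "g \<in> carrier aut_tree"
  using assms by (simp add: aut_tree_def)

lemma aut_tree_carrierD:
  assumes "g \<in> carrier aut_tree"
  shows "bij g" "g [] = []" "adjacent (g u) (g v) \<longleftrightarrow> adjacent u v"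
  using assms by (simp_all add: aut_tree_def)

lemma group_aut_tree: "group aut_tree"
proof (rule groupI)
  fix g assume g: "g \<in> carrier aut_tree"
  note * = aut_tree_carrierD[OF g]
  have i: "g (inv_into UNIV g u) = u" for u
    using *(1) by (simp add: bij_is_surj surj_f_inv_f)
  have "inv_into UNIV g \<in> carrier aut_tree"
  proof (rule aut_tree_carrierI)
    show "bij (inv_into UNIV g)" using *(1) by (rule bij_imp_bij_inv)
    show "inv_into UNIV g [] = []" using *(1,2) by (metis bij_inv_eq_iff)
    show "adjacent (inv_into UNIV g u) (inv_into UNIV g v) \<longleftrightarrow> adjacent u v" for u v
      using *(3)[of "inv_into UNIV g u" "inv_into UNIV g v"] by (simp add: i)
  qed
  moreover have "inv_into UNIV g \<otimes>\<^bsub>aut_tree\<^esub> g = \<one>\<^bsub>aut_tree\<^esub>"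
    by (simp add: aut_tree_def fun_eq_iff i)
  ultimately show "\<exists>h\<in>carrier aut_tree. h \<otimes>\<^bsub>aut_tree\<^esub> g = \<one>\<^bsub>aut_tree\<^esub>" by blast
qed (auto simp: aut_tree_def bij_comp comp_assoc)

lemma aut_tree_length_child:
  assumes g: "g \<in> carrier aut_tree"
  shows "length (g u) = length u \<and> (u \<noteq> [] \<longrightarrow> child (g (butlast u)) (g u))"
proof (induction u rule: rev_induct)
  case Nil
  then show ?case using aut_tree_carrierD(2)[OF g] by simp
next
  case (snoc x u)
  have "adjacent u (u @ [x])" by (auto simp: adjacent_def child_def)
  hence "adjacent (g u) (g (u @ [x]))" using aut_tree_carrierD(3)[OF g] by simp
  moreover have "\<not> child (g (u @ [x])) (g u)"
  proof
    assume c: "child (g (u @ [x])) (g u)"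
    hence "u \<noteq> []" using aut_tree_carrierD(2)[OF g] by (auto simp: child_def)
    hence "child (g (butlast u)) (g u)" using snoc by simp
    with c have "g (butlast u) = g (u @ [x])" by (auto simp: child_def)
    hence "butlast u = u @ [x]"
      using aut_tree_carrierD(1)[OF g] by (meson bij_is_inj injD)
    hence "length (butlast u) = length (u @ [x])" by simp
    thus False by simp
  qed
  ultimately have "child (g u) (g (u @ [x]))" by (auto simp: adjacent_def)
  moreover from this have "length (g (u @ [x])) = Suc (length u)"
    using snoc by (auto simp: child_def)
  ultimately show ?case by simp
qed

lemma child_imp_child:
  assumes "g \<in> carrier aut_tree" "child u v"
  shows "child (g u) (g v)"
  using aut_tree_length_child[OF assms(1), of v] assms(2) by (auto simp: child_def)

lemma hd_aut_tree:
  assumes g: "g \<in> carrier aut_tree"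
  shows "hd (g (x # w)) = hd (g [x])"
proof (induction w rule: rev_induct)
  case (snoc y w)
  have "child (g (x # w)) (g ((x # w) @ [y]))"
    by (rule child_imp_child[OF g]) (auto simp: child_def)
  moreover have "g (x # w) \<noteq> []"
    using aut_tree_length_child[OF g, of "x # w"] by auto
  ultimately show ?case using snoc by (auto simp: child_def)
qed simp

lemma wreath_decomposition:
  assumes g: "g \<in> carrier aut_tree"
  shows "g = wreath (section1 g 0) (section1 g 1) (root_activity g)" (is "g = ?h")
proof
  fix w
  show "g w = ?h w"
  proof (cases w)
    case Nil
    then show ?thesis using aut_tree_carrierD(2)[OF g] by simp
  next
    case (Cons x v)
    have ne: "g (x # v) \<noteq> []" for x v
      using aut_tree_length_child[OF g, of "x # v"] by auto
    have l1: "length (g [x]) = 1" for x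
      using aut_tree_length_child[OF g, of "[x]"] by simp
    have "g [0] \<noteq> g [1]"
      using aut_tree_carrierD(1)[OF g] by (metis bij_is_inj injD list.inject zero_neq_one)
    hence "hd (g [0]) \<noteq> hd (g [1])"
      using l1[of 0] l1[of 1] by (auto simp: length_Suc_conv)
    hence "hd (g [1]) = hd (g [0]) + 1"
      by (cases "hd (g [0])"; cases "hd (g [1])") auto
    hence "hd (g (x # v)) = x + root_activity g"
      using hd_aut_tree[OF g, of x v] by (cases x) (auto simp: root_activity_def)
    moreover have "g (x # v) = hd (g (x # v)) # tl (g (x # v))" using ne by simp
    ultimately show ?thesis
      using Cons by (cases x) (auto simp: section1_def)
  qed
qed

lemma wreath_unique:
  "section1 (wreath g0 g1 e) 0 = g0"
  "section1 (wreath g0 g1 e) 1 = g1"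
  "root_activity (wreath g0 g1 e) = e"
  by (simp_all add: section1_def root_activity_def)

lemma child_Cons_Cons: "child (x # u) (y # v) \<longleftrightarrow> x = y \<and> child u v"
  by (auto simp: child_def)

lemma adjacent_Cons_Cons: "adjacent (x # u) (y # v) \<longleftrightarrow> x = y \<and> adjacent u v"
  by (auto simp: adjacent_def child_Cons_Cons)

lemma section1_in_aut_tree:
  assumes g: "g \<in> carrier aut_tree"
  shows "section1 g x \<in> carrier aut_tree"
proof (rule aut_tree_carrierI)
  let ?s = "section1 g" and ?e = "root_activity g"
  have eq: "g (x # w) = (x + ?e) # ?s x w" for x w
    using arg_cong[OF wreath_decomposition[OF g], of "\<lambda>f. f (x # w)"] by (cases x) auto
  show "?s x [] = []"
    using aut_tree_length_child[OF g, of "[x]"]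
    by (auto simp: section1_def length_Suc_conv)
  show "adjacent (?s x u) (?s x v) \<longleftrightarrow> adjacent u v" for u v
    using aut_tree_carrierD(3)[OF g, of "x # u" "x # v"] by (simp add: eq adjacent_Cons_Cons)
  show "bij (?s x)"
  proof (rule bijI)
    have "inj g" using aut_tree_carrierD(1)[OF g] by (rule bij_is_inj)
    show "inj (?s x)"
    proof (rule injI)
      fix u v assume "?s x u = ?s x v"
      hence "g (x # u) = g (x # v)" by (simp add: eq)
      thus "u = v" using \<open>inj g\<close> by (auto dest: injD)
    qed
    show "surj (?s x)"
      unfolding surj_def
    proof
      fix w
      obtain v where v: "(x + ?e) # w = g v"
        using bij_is_surj[OF aut_tree_carrierD(1)[OF g]] by (metis surj_def)
      moreover have "v \<noteq> []"
        using v aut_tree_carrierD(2)[OF g] by auto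
      then obtain y u where "v = y # u" by (cases v) auto
      ultimately have "x + ?e = y + ?e" "w = ?s y u" by (simp_all only: eq list.inject)
      thus "\<exists>u. w = ?s x u" by (auto simp only: add_right_cancel)
    qed
  qed
qed

lemma involution_in_aut_tree:
  assumes inv: "\<And>w. f (f w) = w"
    and Nil: "f [] = []"
    and ch: "\<And>w x. child (f w) (f (w @ [x]))"
  shows "f \<in> carrier aut_tree"
proof (rule aut_tree_carrierI)
  have ch': "child (f u) (f v)" if "child u v" for u v
    using that ch by (auto simp: child_def[of u v])
  have "child (f u) (f v) \<longleftrightarrow> child u v" for u v
    using ch'[of u v] ch'[of "f u" "f v"] by (auto simp: inv)
  thus "adjacent (f u) (f v) \<longleftrightarrow> adjacent u v" for u v by (simp add: adjacent_def)
  show "bij f" by (rule involuntory_imp_bij) (rule inv)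
qed (rule Nil)

lemma child_snoc: "child w (w @ [x])"
  by (simp add: child_def)

lemma grig_a_aut: "grig_a \<in> carrier aut_tree"
proof (rule involution_in_aut_tree)
  show "grig_a (grig_a w) = w" for w by (cases w) (auto simp: add.assoc)
  show "child (grig_a w) (grig_a (w @ [x]))" for w x
    by (cases w) (auto simp: child_def)
qed simp

lemma grig_bcd_involution:
  "grig_b (grig_b w) = w" "grig_c (grig_c w) = w" "grig_d (grig_d w) = w"
proof -
  have a: "grig_a (grig_a w) = w" for w by (cases w) (auto simp: add.assoc)
  show "grig_b (grig_b w) = w" "grig_c (grig_c w) = w" "grig_d (grig_d w) = w"
    by (induction w and w and w rule: grig_b_grig_c_grig_d.induct) (auto simp: a)
qed

lemma grig_bcd_child:
  "child (grig_b w) (grig_b (w @ [y]))"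
  "child (grig_c w) (grig_c (w @ [y]))"
  "child (grig_d w) (grig_d (w @ [y]))"
proof -
  have a: "child (grig_a w) (grig_a (w @ [y]))" for w
    by (cases w) (auto simp: child_def)
  have n: "child [] [z]" for z by (simp add: child_def)
  show "child (grig_b w) (grig_b (w @ [y]))"
    "child (grig_c w) (grig_c (w @ [y]))"
    "child (grig_d w) (grig_d (w @ [y]))"
    by (induction w and w and w rule: grig_b_grig_c_grig_d.induct)
       (auto simp: a n child_Cons_Cons child_snoc)
qed

lemma generators_in_aut_tree: "{grig_a, grig_b, grig_c, grig_d} \<subseteq> carrier aut_tree"
  using grig_a_aut
  by (auto intro!: involution_in_aut_tree simp: grig_bcd_involution grig_bcd_child)

lemma subgroup_grigorchuk: "subgroup grigorchuk aut_tree"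
  unfolding grigorchuk_def
  by (rule group.generate_is_subgroup[OF group_aut_tree generators_in_aut_tree])

end

theory Submission
  imports Defs
begin

text \<open>
  The value \<open>\<beta>\<close> satisfies the cocycle identity
  \<open>\<beta>\<^bsub>u\<^esub>(g h) = \<beta>\<^bsub>u\<^esub>(g) + \<beta>\<^bsub>u^g\<^esub>(h)\<close> at every vertex \<open>u\<close> of level 2, because the action
  preserves siblings. Up to a constant vector, the constraints prescribe \<open>\<beta>\<close> as a function of
  \<open>(\<alpha>\<^bsub>0\<^esub>, \<alpha>\<^bsub>1\<^esub>)\<close>, and this function is itself a cocycle for the action on level 2. Hence the
  constraints survive products, and it suffices to verify them on the generators.
\<close>

lemma aut_tree_Cons:
  assumes "g \<in> carrier aut_tree"
  shows "g (x # w) = (x + root_activity g) # section1 g x w"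
  using fun_cong[OF wreath_decomposition[OF assms], of "x # w"] by (cases x) auto

lemma section_at_Cons: "section_at g (x # u) = section_at (section1 g x) u"
  by (simp add: section_at_def)

lemma alpha_Nil: "alpha g [] = root_activity g"
  by (simp add: alpha_def section_at_Nil)

lemma alpha_Cons: "alpha g (x # u) = alpha (section1 g x) u"
  by (simp add: alpha_def section_at_Cons)

lemma section1_comp:
  assumes "g \<in> carrier aut_tree"
  shows "section1 (h \<circ> g) x = section1 h (x + root_activity g) \<circ> section1 g x"
  by (simp add: fun_eq_iff section1_def[of "h \<circ> g"] section1_def[of h] aut_tree_Cons[OF assms])

lemma root_activity_comp:
  assumes "g \<in> carrier aut_tree" "h \<in> carrier aut_tree"
  shows "root_activity (h \<circ> g) = root_activity g + root_activity h"
  by (simp add: root_activity_def[of "h \<circ> g"] aut_tree_Cons[OF assms(1)] aut_tree_Cons[OF assms(2)])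

text \<open>The section of the product at a letter is again a product: the section of
  \<open>g\<close> at \<open>x\<close> followed by the section of \<open>h\<close> at the image of
  \<open>x\<close>. Hence the induction on \<open>u\<close> must generalize over both
  automorphisms.\<close>

lemma alpha_comp:
  assumes "g \<in> carrier aut_tree" "h \<in> carrier aut_tree"
  shows "alpha (h \<circ> g) u = alpha g u + alpha h (g u)"
  using assms
proof (induction u arbitrary: g h)
  case Nil
  then show ?case by (simp only: alpha_Nil root_activity_comp aut_tree_carrierD(2))
next
  case (Cons x u)
  then show ?case
    by (simp only: alpha_Cons section1_comp aut_tree_Cons[OF Cons.prems(1)] section1_in_aut_tree)
qed

lemma aut_tree_apply_level1:
  assumes "g \<in> carrier aut_tree"
  shows "g [x] = [x + alpha g []]"
  by (simp add: aut_tree_Cons[OF assms] alpha_Nil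
      aut_tree_carrierD(2)[OF section1_in_aut_tree[OF assms]])

lemma aut_tree_apply_level2:
  assumes "g \<in> carrier aut_tree"
  shows "g [x, y] = [x + alpha g [], y + alpha g [x]]"
  by (simp add: aut_tree_Cons[OF assms] alpha_Nil alpha_Cons
      aut_tree_apply_level1[OF section1_in_aut_tree[OF assms]])

lemma aut_tree_apply_level3:
  assumes "g \<in> carrier aut_tree"
  shows "g [x, y, z] = [x + alpha g [], y + alpha g [x], z + alpha g [x, y]]"
  by (simp add: aut_tree_Cons[OF assms] alpha_Nil alpha_Cons
      aut_tree_apply_level2[OF section1_in_aut_tree[OF assms]])

lemma beta_comp:
  assumes "g \<in> carrier aut_tree" "h \<in> carrier aut_tree"
  shows "beta (h \<circ> g) x y = beta g x y + beta h (x + alpha g []) (y + alpha g [x])"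
proof -
  \<comment> \<open>\<open>g\<close> may swap the two children of the sibling vertex, but
    \<open>beta\<close> sees them only through their sum. Here \<open>s\<close> stands for the
    activity of \<open>g\<close> at the sibling of \<open>[x, y]\<close>.\<close>
  have "alpha h [x', y', 0 + s] + alpha h [x', y', 1 + s] =
      alpha h [x', y', 0] + alpha h [x', y', 1]" for x' y' s
    by (cases s) (simp_all add: add.commute del: add_bit_eq_xor)
  from this[of "x + alpha g []" "y + 1 + alpha g [x]" "alpha g [x, y + 1]"] show ?thesis
    by (simp add: beta_def alpha_comp[OF assms] aut_tree_apply_level2[OF assms(1)]
        aut_tree_apply_level3[OF assms(1)] ac_simps del: add_bit_eq_xor)
qed

text \<open>The four cases of the theorem as polynomial identities over \<open>\<int>/2\<int>\<close>.\<close>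

definition beta_constraint :: "(vertex \<Rightarrow> vertex) \<Rightarrow> bool" where
  "beta_constraint g \<longleftrightarrow>
     beta g 0 0 = beta g 1 1 + (1 + alpha g [0]) * alpha g [1] \<and>
     beta g 0 1 = beta g 1 1 + alpha g [0] * alpha g [1] \<and>
     beta g 1 0 = beta g 1 1 + alpha g [0]"

lemma beta_constraint_comp:
  assumes "g \<in> carrier aut_tree" "h \<in> carrier aut_tree"
    and "beta_constraint g" "beta_constraint h"
  shows "beta_constraint (h \<circ> g)"
proof -
  note eqs = assms(3,4)[unfolded beta_constraint_def]
  show ?thesis
    unfolding beta_constraint_def beta_comp[OF assms(1,2)] alpha_comp[OF assms(1,2)]
      aut_tree_apply_level1[OF assms(1)]
    \<comment> \<open>By \<open>eqs\<close>, all the \<open>beta\<close> values of both factors are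
      determined by these seven bits; \<open>alpha g []\<close> and the activities of
      \<open>g\<close> on level 1 select which values of \<open>h\<close> are paired with those of
      \<open>g\<close>.\<close>
    by (cases "alpha g []"; cases "alpha g [0]"; cases "alpha g [1]";
        cases "alpha h [0]"; cases "alpha h [1]"; cases "beta g 1 1"; cases "beta h 1 1")
      (simp_all add: eqs del: add_bit_eq_xor)
qed

text \<open>The generators together with \<open>id\<close> are closed under sections, so their
  decorations at explicit vertices are found by rewriting alone.\<close>

lemma section1_generators:
  "section1 grig_a x = id"
  "section1 grig_b x = (if x = 0 then grig_a else grig_c)"
  "section1 grig_c x = (if x = 0 then grig_a else grig_d)"
  "section1 grig_d x = (if x = 0 then id else grig_b)"
  "section1 id x = id"
  by (auto simp: section1_def fun_eq_iff)

lemma root_activity_generators: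
  "root_activity grig_a = 1" "root_activity grig_b = 0" "root_activity grig_c = 0"
  "root_activity grig_d = 0" "root_activity id = 0"
  by (simp_all add: root_activity_def)

lemma beta_constraint_generators:
  assumes "g \<in> {id, grig_a, grig_b, grig_c, grig_d}"
  shows "beta_constraint g"
proof -
  consider "g = id" | "g = grig_a" | "g = grig_b" | "g = grig_c" | "g = grig_d"
    using assms by blast
  then show ?thesis
    by cases (simp_all add: beta_constraint_def beta_def alpha_Cons alpha_Nil section1_generators
        root_activity_generators)
qed

lemma inv_generators:
  assumes "g \<in> {grig_a, grig_b, grig_c, grig_d}"
  shows "inv\<^bsub>aut_tree\<^esub> g = g"
proof (rule group.inv_equality[OF group_aut_tree])
  have "grig_a (grig_a w) = w" for w by (cases w) (auto simp: add.assoc)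
  with assms show "g \<otimes>\<^bsub>aut_tree\<^esub> g = \<one>\<^bsub>aut_tree\<^esub>"
    by (auto simp: aut_tree_def fun_eq_iff grig_bcd_involution)
qed (use assms generators_in_aut_tree in auto)

lemma grigorchuk_beta_constraint:
  assumes "g \<in> grigorchuk"
  shows "beta_constraint g"
  using assms unfolding grigorchuk_def
proof (induction g rule: generate.induct)
  case one
  have "\<one>\<^bsub>aut_tree\<^esub> = id" by (simp add: aut_tree_def)
  then show ?case using beta_constraint_generators[OF insertI1] by (simp only:)
next
  case (incl g)
  then show ?case using beta_constraint_generators by auto
next
  case (inv g)
  then show ?case using beta_constraint_generators[of g] inv_generators[of g] by auto
next
  case (eng g h)
  note carrier = group.generate_in_carrier[OF group_aut_tree generators_in_aut_tree]
  have "g \<otimes>\<^bsub>aut_tree\<^esub> h = h \<circ> g" by (simp add: aut_tree_def)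
  then show ?case
    using beta_constraint_comp[OF carrier[OF eng.hyps(1)] carrier[OF eng.hyps(2)] eng.IH]
    by (simp only:)
qed

theorem theorem1:
  fixes g :: "vertex \<Rightarrow> vertex"
  assumes "g \<in> grigorchuk"
  shows "(alpha g [0] = 0 \<and> alpha g [1] = 0 \<longrightarrow>
           beta g 0 0 = beta g 1 1 \<and> beta g 1 1 = beta g 0 1 \<and> beta g 0 1 = beta g 1 0) \<and>
         (alpha g [0] = 0 \<and> alpha g [1] = 1 \<longrightarrow>
           beta g 0 0 \<noteq> beta g 1 1 \<and> beta g 1 1 = beta g 0 1 \<and> beta g 0 1 = beta g 1 0) \<and>
         (alpha g [0] = 1 \<and> alpha g [1] = 0 \<longrightarrow>
           beta g 0 0 = beta g 1 1 \<and> beta g 1 1 = beta g 0 1 \<and> beta g 0 1 \<noteq> beta g 1 0) \<and>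
         (alpha g [0] = 1 \<and> alpha g [1] = 1 \<longrightarrow>
           beta g 0 0 = beta g 1 1 \<and> beta g 1 1 \<noteq> beta g 0 1 \<and> beta g 0 1 = beta g 1 0)"
  using grigorchuk_beta_constraint[OF assms] unfolding beta_constraint_def
  \<comment> \<open>Fixing \<open>beta g 1 1\<close> as well makes every \<open>beta\<close> value
    an explicit bit, which decides the inequalities.\<close>
  by (cases "alpha g [0]"; cases "alpha g [1]"; cases "beta g 1 1") simp_all

end
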